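(* An oriented graph $D$ is a Q-graph if and only if it is a global Q-graph.
   Context: **Digraphs.** A digraph is an irreflexive binary relation $D$ on a finite nonempty set, the set of vertices of $D$. The ordered pairs in $D$ are its edges; an edge $(a,b)$ begins in $a$ and ends in $b$. An oriented graph is an antisymmetric digraph. A W-vertex of $D$ is a vertex in which no edge ends; an E-vertex is a vertex in which no edge begins; an inner vertex is one that is neither. A W-edge is an edge beginning in a W-vertex; an E-edge is an edge ending in an E-vertex. A W-edge $(a,b)$ is functional when $(a,c)\in D$ implies $c=b$; an E-edge $(b,a)$ is functional when $(c,a)\in D$ implies $c=b$. Digraphs are disjoint when their vertex sets are disjoint. **Q-graphs.** For $n\ge 1$ consider a sequence $a_1,\dots,a_n$ of vertices such that for every $i\in\{1,\dots,n-1\}$ we have $(a_i,a_{i+1})\in D$ or $(a_{i+1},a_i)\in D$. It is a semipath (joining $a_1$ to $a_n$) when all its vertices are mutually distinct; it is a semicycle when $a_1=a_n$, $n\ge 4$, and $a_1,\dots,a_{n-1}$ are mutually distinct. $D$ is weakly connected when every two vertices are joined by a semipath; asemicyclic when it has no semicycles; W-E-functional when all its W-edges and E-edges are functional. A Q-graph is an oriented graph that is weakly connected, asemicyclic, W-E-functional and has an inner vertex. **Basic Q-graphs.** A basic Q-graph $B$ is an oriented graph with vertices $a_1,\dots,a_{k_W},b,c_1,\dots,c_{k_E}$ (all distinct, $k_W,k_E\ge 1$) and edges exactly $(a_i,b)$ for $1\le i\le k_W$ and $(b,c_j)$ for $1\le j\le k_E$, together with distinguished W-edges $NW(B),SW(B)$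 and distinguished E-edges $NE(B),SE(B)$ (no further condition; $NX(B)=SX(B)$ is allowed for $X\in\{W,E\}$). **Cut.** Let $D_W,D_E$ be disjoint oriented graphs, $e_W=(a,b)$ a functional E-edge of $D_W$ and $e_E=(c,d)$ a functional W-edge of $D_E$. With $e=(a,d)$, $D_W[e_W-e_E]D_E$ is the oriented graph $(D_W-\{e_W\})\cup(D_E-\{e_E\})\cup\{e\}$ on the union of the vertices of $D_W$ and $D_E$ with $b$ and $c$ omitted. **Constructions and global Q-graphs.** A construction $G$ is a finite binary tree with an oriented graph and distinguished edges at each node; the graph at the root is the root graph of $G$, and its distinguished edges at the root are denoted $YX(G)$, $Y\in\{N,S\}$, $X\in\{W,E\}$. Constructions are defined inductively: (1) a single-node tree whose node carries a basic Q-graph $B$ with its distinguished edges is a construction; (2) if $G_W,G_E$ are constructions with disjoint root graphs $D_W,D_E$, $e_W$ is a functional E-edge of $D_W$ and $e_E$ is a functional W-edge of $D_E$, and for every $Y\in\{N,S\}$ we have $e_W=YE(G_W)$ or $e_E=YW(G_E)$, then $G=G_W[e_W-e_E]G_E$ is a construction: its tree has a new root whose successors are the roots of $G_W$ and $G_E$, its root graph is $D_W[e_W-e_E]D_E$, and for $Y\in\{N,S\}$, $YW(G)=YW(G_W)$ if $e_E=YW(G_E)$ and $YW(G)=YW(G_E)$ otherwise; $YE(G)=YE(G_E)$ if $e_W=YE(G_W)$ and $YE(G)=YE(G_W)$ otherwise. The other nodes keep their data from $G_W$ and $G_E$. A global Q-graph is an oriented graph that is the root graph of a construction. *)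

theory Defs
  imports "Graph_Theory.Pair_Digraph" "HOL-Library.Infinite_Typeclass"
begin

section \<open>Digraphs\<close>

text \<open>The graphs are the pair digraphs of the library, whose arcs are ordered pairs of vertices;
  its locale \<open>pair_digraph\<close> says: finite, and no loops. Nonemptiness has to be added.\<close>

definition nonempty_digraph :: "'a pair_pre_digraph \<Rightarrow> bool" where
  "nonempty_digraph D \<longleftrightarrow> pair_digraph D \<and> pverts D \<noteq> {}"

definition oriented_graph :: "'a pair_pre_digraph \<Rightarrow> bool" where
  "oriented_graph D \<longleftrightarrow> nonempty_digraph D \<and> antisym (parcs D)"

definition W_vertex :: "'a pair_pre_digraph \<Rightarrow> 'a \<Rightarrow> bool" where
  "W_vertex D a \<longleftrightarrow> a \<in> pverts D \<and> (\<nexists>b. (b, a) \<in> parcs D)"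

definition E_vertex :: "'a pair_pre_digraph \<Rightarrow> 'a \<Rightarrow> bool" where
  "E_vertex D a \<longleftrightarrow> a \<in> pverts D \<and> (\<nexists>b. (a, b) \<in> parcs D)"

definition inner_vertex :: "'a pair_pre_digraph \<Rightarrow> 'a \<Rightarrow> bool" where
  "inner_vertex D a \<longleftrightarrow> a \<in> pverts D \<and> \<not> W_vertex D a \<and> \<not> E_vertex D a"

definition W_edge :: "'a pair_pre_digraph \<Rightarrow> 'a \<times> 'a \<Rightarrow> bool" where
  "W_edge D e \<longleftrightarrow> e \<in> parcs D \<and> W_vertex D (fst e)"

definition E_edge :: "'a pair_pre_digraph \<Rightarrow> 'a \<times> 'a \<Rightarrow> bool" where
  "E_edge D e \<longleftrightarrow> e \<in> parcs D \<and> E_vertex D (snd e)"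

definition functional_W_edge :: "'a pair_pre_digraph \<Rightarrow> 'a \<times> 'a \<Rightarrow> bool" where
  "functional_W_edge D e \<longleftrightarrow>
     W_edge D e \<and> (\<forall>c. (fst e, c) \<in> parcs D \<longrightarrow> c = snd e)"

definition functional_E_edge :: "'a pair_pre_digraph \<Rightarrow> 'a \<times> 'a \<Rightarrow> bool" where
  "functional_E_edge D e \<longleftrightarrow>
     E_edge D e \<and> (\<forall>c. (c, snd e) \<in> parcs D \<longrightarrow> c = fst e)"


section \<open>Q-graphs\<close>

definition semiwalk :: "'a pair_pre_digraph \<Rightarrow> 'a list \<Rightarrow> bool" where
  "semiwalk D p \<longleftrightarrow> p \<noteq> [] \<and> set p \<subseteq> pverts D \<and>
     (\<forall>i. Suc i < length p \<longrightarrow>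
        (p ! i, p ! Suc i) \<in> parcs D \<or> (p ! Suc i, p ! i) \<in> parcs D)"

definition semipath :: "'a pair_pre_digraph \<Rightarrow> 'a list \<Rightarrow> bool" where
  "semipath D p \<longleftrightarrow> semiwalk D p \<and> distinct p"

definition semicycle :: "'a pair_pre_digraph \<Rightarrow> 'a list \<Rightarrow> bool" where
  "semicycle D p \<longleftrightarrow>
     semiwalk D p \<and> hd p = last p \<and> 4 \<le> length p \<and> distinct (butlast p)"

definition weakly_connected :: "'a pair_pre_digraph \<Rightarrow> bool" where
  "weakly_connected D \<longleftrightarrow>
     (\<forall>a \<in> pverts D. \<forall>b \<in> pverts D. \<exists>p. semipath D p \<and> hd p = a \<and> last p = b)"

definition asemicyclic :: "'a pair_pre_digraph \<Rightarrow> bool" where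
  "asemicyclic D \<longleftrightarrow> (\<nexists>p. semicycle D p)"

definition WE_functional :: "'a pair_pre_digraph \<Rightarrow> bool" where
  "WE_functional D \<longleftrightarrow>
     (\<forall>e. W_edge D e \<longrightarrow> functional_W_edge D e) \<and>
     (\<forall>e. E_edge D e \<longrightarrow> functional_E_edge D e)"

definition Q_graph :: "'a pair_pre_digraph \<Rightarrow> bool" where
  "Q_graph D \<longleftrightarrow> oriented_graph D \<and> weakly_connected D \<and> asemicyclic D \<and>
     WE_functional D \<and> (\<exists>a. inner_vertex D a)"


section \<open>Global Q-graphs\<close>

datatype ns = North | South
datatype we = West | East

text \<open>A graph together with its distinguished edges: \<open>mark x Y X\<close> is the edge \<open>YX\<close>.\<close>

datatype 'a marked_graph =
  Marked (graph: "'a pair_pre_digraph") (mark: "ns \<Rightarrow> we \<Rightarrow> 'a \<times> 'a")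

definition basic_Q_graph :: "'a marked_graph \<Rightarrow> bool" where
  "basic_Q_graph B \<longleftrightarrow>
     oriented_graph (graph B) \<and>
     (\<exists>A b C. finite A \<and> A \<noteq> {} \<and> finite C \<and> C \<noteq> {} \<and>
        A \<inter> C = {} \<and> b \<notin> A \<and> b \<notin> C \<and>
        pverts (graph B) = A \<union> {b} \<union> C \<and>
        parcs (graph B) = A \<times> {b} \<union> {b} \<times> C) \<and>
     (\<forall>Y. W_edge (graph B) (mark B Y West) \<and> E_edge (graph B) (mark B Y East))"

definition cut_graph ::
  "'a pair_pre_digraph \<Rightarrow> 'a \<times> 'a \<Rightarrow> 'a \<times> 'a \<Rightarrow> 'a pair_pre_digraph \<Rightarrow> 'a pair_pre_digraph" where
  "cut_graph DW eW eE DE =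
     \<lparr> pverts = (pverts DW \<union> pverts DE) - {snd eW, fst eE},
       parcs = (parcs DW - {eW}) \<union> (parcs DE - {eE}) \<union> {(fst eW, snd eE)} \<rparr>"

definition cut_mark ::
  "'a marked_graph \<Rightarrow> 'a \<times> 'a \<Rightarrow> 'a \<times> 'a \<Rightarrow> 'a marked_graph \<Rightarrow> ns \<Rightarrow> we \<Rightarrow> 'a \<times> 'a" where
  "cut_mark xW eW eE xE Y X =
     (case X of
        West \<Rightarrow> (if eE = mark xE Y West then mark xW Y West else mark xE Y West)
      | East \<Rightarrow> (if eW = mark xW Y East then mark xE Y East else mark xW Y East))"

datatype 'a qtree =
    Tip (root: "'a marked_graph")
  | Branch (root: "'a marked_graph") "'a qtree" "'a qtree"

abbreviation root_graph :: "'a qtree \<Rightarrow> 'a pair_pre_digraph" where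
  "root_graph G \<equiv> graph (root G)"

abbreviation root_mark :: "'a qtree \<Rightarrow> ns \<Rightarrow> we \<Rightarrow> 'a \<times> 'a" where
  "root_mark G \<equiv> mark (root G)"

inductive construction :: "'a qtree \<Rightarrow> bool" where
  basic: "basic_Q_graph B \<Longrightarrow> construction (Tip B)"
| cut: "\<lbrakk> construction GW; construction GE;
         pverts (root_graph GW) \<inter> pverts (root_graph GE) = {};
         functional_E_edge (root_graph GW) eW;
         functional_W_edge (root_graph GE) eE;
         \<And>Y. eW = root_mark GW Y East \<or> eE = root_mark GE Y West \<rbrakk>
    \<Longrightarrow> construction
          (Branch
             (Marked (cut_graph (root_graph GW) eW eE (root_graph GE))
                (cut_mark (root GW) eW eE (root GE)))
             GW GE)"

text \<open>A construction of \<open>D\<close> uses vertices that are omitted in \<open>D\<close>. These come from the same type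
  as the vertices of \<open>D\<close>, so the notion is the intended one only over an infinite vertex type,
  where there is always a supply of further vertices.\<close>

definition global_Q_graph :: "'a::infinite pair_pre_digraph \<Rightarrow> bool" where
  "global_Q_graph D \<longleftrightarrow> oriented_graph D \<and> (\<exists>G. construction G \<and> root_graph G = D)"

end

theory Submission
  imports Defs
begin

text \<open>An oriented graph is weakly connected and asemicyclic iff any two vertices are linked by arcs
  and every arc is a bridge, i.e. deleting it unlinks its ends. In this form both properties
  are transported by maps: a cut of two graphs collapses onto either of them, and conversely.

  For the hard direction, cut a Q-graph at any arc between two inner vertices and apply induction
  to the two parts. To satisfy the condition on distinguished edges one proves more: for every
  E-edge \<open>e\<close> there is a construction with \<open>NE = SE = e\<close>, and dually for W-edges. If \<open>e\<close> lies in the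
  E-part, take both E-marks of the W-part to be the cut edge; if \<open>e\<close> lies in the W-part, take both
  W-marks of the E-part to be the cut edge and both E-marks of the W-part to be \<open>e\<close>. Without an
  arc between inner vertices the graph is basic.\<close>

section \<open>Connectivity as a symmetric closure\<close>

text \<open>The equivalence relation generated by \<open>r\<close> on the whole type. A point that
  no arc of \<open>r\<close> touches is linked only to itself, so no vertex set has to be carried
  along.\<close>

definition linked :: "'a rel \<Rightarrow> 'a rel" where
  "linked r = (r \<union> r\<inverse>)\<^sup>*"

lemma linked_refl [simp]: "(x, x) \<in> linked r"
  by (simp add: linked_def)

lemma linked_arc: "(x, y) \<in> r \<Longrightarrow> (x, y) \<in> linked r"
  by (auto simp: linked_def)

lemma linked_sym: "(x, y) \<in> linked r \<Longrightarrow> (y, x) \<in> linked r"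
  unfolding linked_def by (metis Un_commute converse_Un converse_converse rtrancl_converseI)

lemma linked_trans: "(x, y) \<in> linked r \<Longrightarrow> (y, z) \<in> linked r \<Longrightarrow> (x, z) \<in> linked r"
  unfolding linked_def by (rule rtrancl_trans)

lemma linked_converse [simp]: "linked (r\<inverse>) = linked r"
  by (simp add: linked_def Un_commute)

lemma linked_empty [simp]: "linked {} = Id"
  by (simp add: linked_def)

text \<open>Arcs need only go to linked pairs, not to arcs, so \<open>f\<close> may contract whole
  parts of a graph to a point. All transport between a graph and the parts of a cut rests on
  this.\<close>

lemma linked_hom:
  assumes "(x, y) \<in> linked r" and "\<And>u v. (u, v) \<in> r \<Longrightarrow> (f u, f v) \<in> linked s"
  shows "(f x, f y) \<in> linked s"
proof -
  have "(x, y) \<in> (r \<union> r\<inverse>)\<^sup>*"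
    using assms(1) by (simp add: linked_def)
  then show ?thesis
  proof (induction rule: rtrancl_induct)
    case (step y z)
    then have "(f y, f z) \<in> linked s"
      using assms(2) by (auto intro: linked_sym)
    with step.IH show ?case
      by (rule linked_trans)
  qed simp
qed

text \<open>Apply \<open>linked_hom\<close> to the characteristic function of \<open>S\<close>, with
  the empty relation on \<open>bool\<close> as target: there, linked means equal.\<close>

lemma linked_closed:
  assumes "(x, y) \<in> linked r" and "x \<in> S"
    and "\<And>u v. (u, v) \<in> r \<Longrightarrow> u \<in> S \<longleftrightarrow> v \<in> S"
  shows "y \<in> S"
  using linked_hom[OF assms(1), of "\<lambda>v. v \<in> S" "{}"] assms(2,3) by auto

section \<open>Walks without repeated vertices\<close>

lemma rtrancl_imp_distinct_walk:
  assumes "(x, y) \<in> r\<^sup>*"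
  obtains p where "p \<noteq> []" "hd p = x" "last p = y" "distinct p"
    "successively (\<lambda>u v. (u, v) \<in> r) p"
proof -
  from assms have "\<exists>p. p \<noteq> [] \<and> hd p = x \<and> last p = y \<and> distinct p \<and>
      successively (\<lambda>u v. (u, v) \<in> r) p"
  proof (induction rule: rtrancl_induct)
    case base
    then show ?case by (intro exI[of _ "[x]"]) auto
  next
    case (step y z)
    then obtain p where p: "p \<noteq> []" "hd p = x" "last p = y" "distinct p"
      "successively (\<lambda>u v. (u, v) \<in> r) p" by blast
    show ?case
    \<comment> \<open>If \<open>z\<close> was visited before, the walk is cut back to that visit
      instead of being extended.\<close>
    proof (cases "z \<in> set p")
      case True
      then obtain q q' where "p = q @ z # q'" by (auto simp: in_set_conv_decomp)
      with p show ?thesis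
        by (intro exI[of _ "q @ [z]"]) (auto simp: successively_append_iff hd_append)
    next
      case False
      with p step.hyps show ?thesis
        by (intro exI[of _ "p @ [z]"]) (auto simp: successively_append_iff)
    qed
  qed
  with that show thesis by blast
qed

lemma walk_imp_rtrancl:
  "p \<noteq> [] \<Longrightarrow> successively (\<lambda>u v. (u, v) \<in> r) p \<Longrightarrow> (hd p, last p) \<in> r\<^sup>*"
  by (induction p rule: induct_list012) (auto intro: converse_rtrancl_into_rtrancl)

section \<open>The conditions on Q-graphs in relational form\<close>

lemma oriented_graph_iff:
  "oriented_graph D \<longleftrightarrow> finite (pverts D) \<and> pverts D \<noteq> {} \<and> parcs D \<subseteq> pverts D \<times> pverts D \<and>
     irrefl (parcs D) \<and> antisym (parcs D)"
proof -
  have "pair_digraph D \<longleftrightarrow>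
    finite (pverts D) \<and> parcs D \<subseteq> pverts D \<times> pverts D \<and> irrefl (parcs D)"
    unfolding pair_digraph_def pair_fin_digraph_def pair_wf_digraph_def
      pair_fin_digraph_axioms_def pair_loopfree_digraph_def pair_loopfree_digraph_axioms_def
    by (auto simp: irrefl_def subset_iff intro: finite_subset[of _ "pverts D \<times> pverts D"])
  then show ?thesis
    by (auto simp: oriented_graph_def nonempty_digraph_def)
qed

lemma semiwalk_iff:
  "semiwalk D p \<longleftrightarrow> p \<noteq> [] \<and> set p \<subseteq> pverts D \<and>
     successively (\<lambda>u v. (u, v) \<in> parcs D \<union> (parcs D)\<inverse>) p"
  by (auto simp: semiwalk_def successively_conv_nth)

lemma walk_vertices:
  assumes "successively (\<lambda>u v. (u, v) \<in> r) p" "r \<subseteq> V \<times> V" "p \<noteq> []" "hd p \<in> V"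
  shows "set p \<subseteq> V"
  using assms by (induction p rule: induct_list012) auto

lemma weakly_connected_iff:
  assumes "parcs D \<subseteq> pverts D \<times> pverts D"
  shows "weakly_connected D \<longleftrightarrow> pverts D \<times> pverts D \<subseteq> linked (parcs D)"
proof -
  have "(\<exists>p. semipath D p \<and> hd p = x \<and> last p = y) \<longleftrightarrow> (x, y) \<in> linked (parcs D)"
    if "x \<in> pverts D" for x y
  proof
    assume "\<exists>p. semipath D p \<and> hd p = x \<and> last p = y"
    then obtain p where "p \<noteq> []" "successively (\<lambda>u v. (u, v) \<in> parcs D \<union> (parcs D)\<inverse>) p"
      "hd p = x" "last p = y"
      unfolding semipath_def semiwalk_iff by blast
    then show "(x, y) \<in> linked (parcs D)"
      unfolding linked_def using walk_imp_rtrancl[of p "parcs D \<union> (parcs D)\<inverse>"] by simp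
  next
    assume "(x, y) \<in> linked (parcs D)"
    then obtain p where p: "p \<noteq> []" "hd p = x" "last p = y" "distinct p"
      "successively (\<lambda>u v. (u, v) \<in> parcs D \<union> (parcs D)\<inverse>) p"
      unfolding linked_def by (rule rtrancl_imp_distinct_walk)
    moreover have "set p \<subseteq> pverts D"
      using p assms that by (intro walk_vertices[OF p(5)]) auto
    ultimately show "\<exists>p. semipath D p \<and> hd p = x \<and> last p = y"
      unfolding semipath_def semiwalk_iff by blast
  qed
  then show ?thesis
    by (auto simp: weakly_connected_def subset_iff)
qed

text \<open>Only the ordered pair is deleted. In an antisymmetric relation without loops this
  removes the undirected edge as well, which is why the definition is used for oriented
  graphs.\<close>

definition all_bridges :: "'a rel \<Rightarrow> bool" where
  "all_bridges r \<longleftrightarrow> (\<forall>x y. (x, y) \<in> r \<longrightarrow> (x, y) \<notin> linked (r - {(x, y)}))"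

text \<open>A semicycle amounts to an arc together with a repetition-free walk between its ends that
  avoids the arc in both directions. By \<open>del\<close>, such walks are those that link the ends
  after the deletion.\<close>

lemma asemicyclic_iff:
  assumes "oriented_graph D"
  shows "asemicyclic D \<longleftrightarrow> all_bridges (parcs D)"
proof -
  let ?r = "parcs D"
  let ?U = "?r \<union> ?r\<inverse>"
  have wf: "?r \<subseteq> pverts D \<times> pverts D" and irr: "irrefl ?r" and anti: "antisym ?r"
    using assms by (auto simp: oriented_graph_iff)
  have del: "(?r - {(x, y)}) \<union> (?r - {(x, y)})\<inverse> = ?U - {(x, y), (y, x)}"
    if "(x, y) \<in> ?r" for x y
    using that irr anti by (auto simp: irrefl_def antisym_def)
  show ?thesis
  proof
    assume acyc: "asemicyclic D"
    show "all_bridges ?r"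
      unfolding all_bridges_def
    proof (intro allI impI notI)
      fix x y assume xy: "(x, y) \<in> ?r" and "(x, y) \<in> linked (?r - {(x, y)})"
      then have "(y, x) \<in> linked (?r - {(x, y)})"
        by (simp add: linked_sym)
      then have "(y, x) \<in> (?U - {(x, y), (y, x)})\<^sup>*"
        by (simp add: linked_def del[OF xy])
      then obtain p where p: "p \<noteq> []" "hd p = y" "last p = x" "distinct p"
        "successively (\<lambda>u v. (u, v) \<in> ?U - {(x, y), (y, x)}) p"
        by (rule rtrancl_imp_distinct_walk)
      have "x \<noteq> y"
        using xy irr by (auto simp: irrefl_def)
      \<comment> \<open>The walk cannot be \<open>[y]\<close>, as \<open>x\<close> and
        \<open>y\<close> differ, nor \<open>[y, x]\<close>, as that step is excluded. With three
        vertices in \<open>p\<close>, the closed list \<open>x # p\<close> reaches the required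
        length 4.\<close>
      with p obtain u v q where q: "p = y # u # v # q"
        by (cases p rule: remdups_adj.cases; cases "tl (tl p)") auto
      have "successively (\<lambda>u v. (u, v) \<in> ?U) p"
        by (rule successively_mono[OF p(5)]) auto
      then have "semiwalk D (x # p)"
        using p q xy wf walk_vertices[of ?U p "pverts D"]
        by (auto simp: semiwalk_iff)
      moreover have "distinct (butlast (x # p))"
      proof -
        have "p = butlast p @ [x]"
          using p by (metis append_butlast_last_id)
        with p(4) have "distinct (butlast p @ [x])"
          by simp
        with p(1) show ?thesis
          by simp
      qed
      ultimately have "semicycle D (x # p)"
        using p q by (simp add: semicycle_def)
      with acyc show False
        by (auto simp: asemicyclic_def)
    qed
  next
    assume br: "all_bridges ?r"
    show "asemicyclic D"
      unfolding asemicyclic_def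
    proof
      assume "\<exists>p. semicycle D p"
      then obtain p where p: "semicycle D p" ..
      then obtain x t where pt: "p = x # t"
        by (cases p) (auto simp: semicycle_def)
      define y where "y = hd t"
      have len: "3 \<le> length t"
        using p by (simp add: semicycle_def pt)
      then have "t \<noteq> []"
        by auto
      have lst: "last t = x" and dist: "distinct (x # butlast t)"
        using p \<open>t \<noteq> []\<close> by (auto simp: semicycle_def pt)
      have succ: "(x, y) \<in> ?U" "successively (\<lambda>u v. (u, v) \<in> ?U) t"
        using p \<open>t \<noteq> []\<close> unfolding semicycle_def semiwalk_iff pt y_def successively_Cons by blast+
      have "t = butlast t @ [x]"
        using lst \<open>t \<noteq> []\<close> by (metis append_butlast_last_id)
      then have "distinct t \<longleftrightarrow> distinct (butlast t @ [x])"
        by (rule arg_cong)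
      with dist have "distinct t"
        by simp
      \<comment> \<open>The rest of the semicycle never uses its first edge again: in the
        repetition-free list \<open>t\<close>, \<open>y\<close> occurs only first and
        \<open>x\<close> only last, and with at least three entries these are not adjacent.\<close>
      have "successively (\<lambda>u v. {u, v} \<noteq> {x, y}) t"
        unfolding successively_conv_nth
      proof (intro allI impI notI)
        fix i assume i: "Suc i < length t" and eq: "{t ! i, t ! Suc i} = {x, y}"
        let ?l = "length t - 1"
        have ends: "t ! 0 = y" "t ! ?l = x"
          using lst \<open>t \<noteq> []\<close> by (simp_all add: y_def hd_conv_nth last_conv_nth)
        have inj: "j = k" if "j < length t" "k < length t" "t ! j = t ! k" for j k
          using nth_eq_iff_index_eq[OF \<open>distinct t\<close>] that by blast
        consider "t ! i = t ! ?l" | "t ! i = t ! 0" "t ! Suc i = t ! ?l"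
          using eq ends by (metis doubleton_eq_iff)
        then show False
          using inj[of i ?l] inj[of i 0] inj[of "Suc i" ?l] i len \<open>t \<noteq> []\<close> by cases auto
      qed
      then have "successively (\<lambda>u v. (u, v) \<in> ?U - {(x, y), (y, x)}) t"
        using succ(2) by (auto simp: successively_conv_nth)
      then have yx: "(y, x) \<in> (?U - {(x, y), (y, x)})\<^sup>*"
        using walk_imp_rtrancl[OF \<open>t \<noteq> []\<close>] lst by (simp add: y_def)
      show False
      \<comment> \<open>The first edge of the semicycle may be traversed along or against its
        orientation.\<close>
      proof (cases "(x, y) \<in> ?r")
        case True
        with yx have "(y, x) \<in> linked (?r - {(x, y)})"
          by (simp add: linked_def del)
        with True br show False
          by (auto simp: all_bridges_def dest: linked_sym)
      next
        case False
        with succ have "(y, x) \<in> ?r" by auto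
        moreover from this yx have "(y, x) \<in> linked (?r - {(y, x)})"
          by (simp add: linked_def del insert_commute)
        ultimately show False
          using br by (auto simp: all_bridges_def)
      qed
    qed
  qed
qed

lemma Q_graph_iff:
  "Q_graph D \<longleftrightarrow> oriented_graph D \<and> pverts D \<times> pverts D \<subseteq> linked (parcs D) \<and>
     all_bridges (parcs D) \<and> WE_functional D \<and> (\<exists>a. inner_vertex D a)"
  using weakly_connected_iff[of D] asemicyclic_iff[of D]
  by (auto simp: Q_graph_def oriented_graph_iff)

lemma all_bridges_converse [simp]: "all_bridges (r\<inverse>) \<longleftrightarrow> all_bridges r"
proof -
  have "r\<inverse> - {(x, y)} = (r - {(y, x)})\<inverse>" for x y
    by auto
  then have "linked (r\<inverse> - {(x, y)}) = linked (r - {(y, x)})" for x y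
    by simp
  moreover have "(x, y) \<in> linked s \<longleftrightarrow> (y, x) \<in> linked s" for x y and s :: "'a rel"
    by (blast intro: linked_sym)
  ultimately show ?thesis
    unfolding all_bridges_def converse_iff by metis
qed

lemma WE_functional_iff:
  assumes "parcs D \<subseteq> pverts D \<times> pverts D"
  shows "WE_functional D \<longleftrightarrow>
    (\<forall>x y z. (\<nexists>u. (u, x) \<in> parcs D) \<longrightarrow> (x, y) \<in> parcs D \<longrightarrow> (x, z) \<in> parcs D \<longrightarrow> y = z) \<and>
    (\<forall>x y z. (\<nexists>u. (x, u) \<in> parcs D) \<longrightarrow> (y, x) \<in> parcs D \<longrightarrow> (z, x) \<in> parcs D \<longrightarrow> y = z)"
  using assms
  unfolding WE_functional_def functional_W_edge_def functional_E_edge_def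
    W_edge_def E_edge_def W_vertex_def E_vertex_def split_paired_All fst_conv snd_conv
  by blast

lemma inner_vertex_iff:
  assumes "parcs D \<subseteq> pverts D \<times> pverts D"
  shows "inner_vertex D v \<longleftrightarrow> (\<exists>u. (u, v) \<in> parcs D) \<and> (\<exists>w. (v, w) \<in> parcs D)"
  using assms by (auto simp: inner_vertex_def W_vertex_def E_vertex_def)

section \<open>Reversal of all arcs, which exchanges W and E\<close>

definition rev_graph :: "'a pair_pre_digraph \<Rightarrow> 'a pair_pre_digraph" where
  "rev_graph D = \<lparr>pverts = pverts D, parcs = (parcs D)\<inverse>\<rparr>"

lemma rev_graph_sel [simp]:
  "pverts (rev_graph D) = pverts D" "parcs (rev_graph D) = (parcs D)\<inverse>"
  by (simp_all add: rev_graph_def)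

lemma W_vertex_rev [simp]: "W_vertex (rev_graph D) = E_vertex D"
  and E_vertex_rev [simp]: "E_vertex (rev_graph D) = W_vertex D"
  by (auto simp: W_vertex_def E_vertex_def)

lemma inner_vertex_rev [simp]: "inner_vertex (rev_graph D) = inner_vertex D"
  by (auto simp: inner_vertex_def)

lemma W_edge_rev [simp]: "W_edge (rev_graph D) e \<longleftrightarrow> E_edge D (prod.swap e)"
  and E_edge_rev [simp]: "E_edge (rev_graph D) e \<longleftrightarrow> W_edge D (prod.swap e)"
  by (cases e; auto simp: W_edge_def E_edge_def)+

lemma oriented_graph_rev [simp]: "oriented_graph (rev_graph D) \<longleftrightarrow> oriented_graph D"
  by (auto simp: oriented_graph_iff irrefl_def)

lemma WE_functional_rev [simp]: "WE_functional (rev_graph D) \<longleftrightarrow> WE_functional D"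
  by (auto simp: WE_functional_def functional_W_edge_def functional_E_edge_def split_paired_all)

lemma Q_graph_rev [simp]: "Q_graph (rev_graph D) \<longleftrightarrow> Q_graph D"
  by (simp add: Q_graph_iff)

section \<open>Basic graphs and cuts\<close>

lemma basic_Q_graph_imp_Q_graph:
  assumes "basic_Q_graph B"
  shows "Q_graph (graph B)"
proof -
  define D where "D = graph B"
  obtain A b C where ne: "A \<noteq> {}" "C \<noteq> {}" and disj: "A \<inter> C = {}" "b \<notin> A" "b \<notin> C"
    and V: "pverts D = A \<union> {b} \<union> C" and r: "parcs D = A \<times> {b} \<union> {b} \<times> C"
    and D: "oriented_graph D"
    using assms unfolding basic_Q_graph_def D_def by blast
  have wf: "parcs D \<subseteq> pverts D \<times> pverts D"
    using D by (simp add: oriented_graph_iff)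
  have "(v, b) \<in> linked (parcs D)" if "v \<in> pverts D" for v
    using that unfolding V r by (auto intro: linked_arc linked_sym)
  then have conn: "pverts D \<times> pverts D \<subseteq> linked (parcs D)"
    by (auto intro: linked_trans linked_sym)
  have bridges: "all_bridges (parcs D)"
    unfolding all_bridges_def
  proof (intro allI impI notI)
    fix x y assume xy: "(x, y) \<in> parcs D" and l: "(x, y) \<in> linked (parcs D - {(x, y)})"
    define z where "z = (if x = b then y else x)"
    \<comment> \<open>\<open>z\<close> is the leaf of the arc; without the arc it is isolated.\<close>
    have "y \<in> {v. (v = z) = (x = z)}"
      by (rule linked_closed[OF l]) (use xy disj in \<open>auto simp: r z_def\<close>)
    then show False
      using xy disj by (auto simp: r z_def split: if_splits)
  qed
  have "WE_functional D"
    using disj ne unfolding WE_functional_iff[OF wf] r by blast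
  moreover have "inner_vertex D b"
    using ne unfolding inner_vertex_iff[OF wf] r by blast
  ultimately show ?thesis
    using D conn bridges unfolding Q_graph_iff D_def by blast
qed

text \<open>Connectedness is carried from the two graphs into the cut by a map \<open>h\<close> that
  sends both removed arcs to the new one. Bridges are carried back: a map \<open>g\<close> collapses
  one side of the cut to a single vertex, and a link avoiding an arc would survive the
  collapse.\<close>

lemma Q_graph_cut:
  assumes "Q_graph DW" "Q_graph DE" and disj: "pverts DW \<inter> pverts DE = {}"
    and "functional_E_edge DW eW" "functional_W_edge DE eE"
  shows "Q_graph (cut_graph DW eW eE DE)"
proof -
  obtain a b c d where e: "eW = (a, b)" "eE = (c, d)"
    by (cases eW, cases eE)
  let ?VW = "pverts DW" and ?VE = "pverts DE" and ?rW = "parcs DW" and ?rE = "parcs DE"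
  define D where "D = cut_graph DW eW eE DE"
  have V: "pverts D = (?VW \<union> ?VE) - {b, c}"
    and r: "parcs D = (?rW - {(a, b)}) \<union> (?rE - {(c, d)}) \<union> {(a, d)}"
    by (simp_all add: D_def cut_graph_def e)
  have oW: "oriented_graph DW" and oE: "oriented_graph DE"
    using assms by (simp_all add: Q_graph_iff)
  have wf: "?rW \<subseteq> ?VW \<times> ?VW" "?rE \<subseteq> ?VE \<times> ?VE"
    using oW oE by (simp_all add: oriented_graph_iff)
  \<comment> \<open>Functionality makes \<open>(a, b)\<close> the only arc at \<open>b\<close>, and
    below \<open>(c, d)\<close> the only arc at \<open>c\<close>, so omitting \<open>b\<close> and
    \<open>c\<close> leaves no dangling arc.\<close>
  have ab: "(a, b) \<in> ?rW" "\<And>y. (b, y) \<notin> ?rW" "\<And>x. (x, b) \<in> ?rW \<Longrightarrow> x = a"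
    using assms(4) by (auto simp: e functional_E_edge_def E_edge_def E_vertex_def)
  have cd: "(c, d) \<in> ?rE" "\<And>x. (x, c) \<notin> ?rE" "\<And>y. (c, y) \<in> ?rE \<Longrightarrow> y = d"
    using assms(5) by (auto simp: e functional_W_edge_def W_edge_def W_vertex_def)
  have mem: "a \<in> ?VW" "b \<in> ?VW" "c \<in> ?VE" "d \<in> ?VE"
    using ab(1) cd(1) wf by auto
  have irr: "a \<noteq> b" "c \<noteq> d"
    using ab(1) cd(1) oW oE by (auto simp: oriented_graph_iff irrefl_def)
  have dist: "a \<noteq> c" "a \<noteq> d" "b \<noteq> c" "b \<noteq> d"
    using mem disj by auto
  have notin: "a \<notin> ?VE" "b \<notin> ?VE" "c \<notin> ?VW" "d \<notin> ?VW"
    using mem disj by auto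
  have arcW: "u \<in> ?VW \<and> v \<in> ?VW \<and> u \<notin> ?VE \<and> v \<notin> ?VE \<and> u \<noteq> b \<and> u \<noteq> c \<and> v \<noteq> c \<and>
      u \<noteq> v \<and> (v, u) \<notin> ?rW" if "(u, v) \<in> ?rW" for u v
    using that wf(1) disj ab(2) notin oW
    by (auto simp: oriented_graph_iff irrefl_def dest: antisymD)
  have arcE: "u \<in> ?VE \<and> v \<in> ?VE \<and> u \<notin> ?VW \<and> v \<notin> ?VW \<and> u \<noteq> b \<and> v \<noteq> b \<and> v \<noteq> c \<and>
      u \<noteq> v \<and> (v, u) \<notin> ?rE" if "(u, v) \<in> ?rE" for u v
    using that wf(2) disj cd(2) notin oE
    by (auto simp: oriented_graph_iff irrefl_def dest: antisymD)
  have wfD: "parcs D \<subseteq> pverts D \<times> pverts D"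
  proof (rule subrelI)
    fix u v assume "(u, v) \<in> parcs D"
    then consider "(u, v) \<in> ?rW" "(u, v) \<noteq> (a, b)" | "(u, v) \<in> ?rE" "(u, v) \<noteq> (c, d)"
      | "u = a" "v = d"
      unfolding r by blast
    then show "(u, v) \<in> pverts D \<times> pverts D"
    proof cases
      case 1
      with arcW[of u v] ab(3)[of u] show ?thesis by (auto simp: V)
    next
      case 2
      with arcE[of u v] cd(3)[of v] show ?thesis by (auto simp: V)
    next
      case 3
      with mem irr dist show ?thesis by (auto simp: V)
    qed
  qed
  have "irrefl (parcs D)"
    unfolding r irrefl_def using arcW arcE dist by blast
  moreover have "antisym (parcs D)"
  proof (rule antisymI)
    fix u v assume "(u, v) \<in> parcs D" "(v, u) \<in> parcs D"
    then show "u = v"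
      unfolding r using arcW[of u v] arcW[of v u] arcE[of u v] arcE[of v u] notin mem by blast
  qed
  moreover have "finite (pverts D)" "a \<in> pverts D"
    using oW oE mem irr dist unfolding V oriented_graph_iff by auto
  ultimately have oD: "oriented_graph D"
    using wfD by (auto simp: oriented_graph_iff)
  have conn: "pverts D \<times> pverts D \<subseteq> linked (parcs D)"
  proof -
    \<comment> \<open>Each omitted vertex goes to the vertex that takes its place as an end of
      \<open>(a, d)\<close>; so \<open>(a, b)\<close> and \<open>(c, d)\<close> both become
      \<open>(a, d)\<close>, and all other arcs stay fixed.\<close>
    define h where "h v = (if v = b then d else if v = c then a else v)" for v
    have hW: "(h u, h v) \<in> linked (parcs D)" if "(u, v) \<in> ?rW" for u v
      using that arcW[OF that] ab(3)[of u] by (intro linked_arc) (auto simp: h_def r irr dist)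
    have hE: "(h u, h v) \<in> linked (parcs D)" if "(u, v) \<in> ?rE" for u v
      using that arcE[OF that] cd(3)[of v] by (intro linked_arc) (auto simp: h_def r irr dist)
    have "(v, a) \<in> linked (parcs D)" if "v \<in> ?VW - {b}" for v
    proof -
      have "(v, a) \<in> linked ?rW"
        using assms(1) that mem by (auto simp: Q_graph_iff)
      then have "(h v, h a) \<in> linked (parcs D)"
        by (rule linked_hom) (rule hW)
      moreover have "h v = v" "h a = a"
        using that mem disj irr dist by (auto simp: h_def)
      ultimately show ?thesis by simp
    qed
    moreover have "(v, a) \<in> linked (parcs D)" if "v \<in> ?VE - {c}" for v
    proof -
      have "(v, c) \<in> linked ?rE"
        using assms(2) that mem by (auto simp: Q_graph_iff)
      then have "(h v, h c) \<in> linked (parcs D)"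
        by (rule linked_hom) (rule hE)
      moreover have "h v = v" "h c = a"
        using that mem disj irr dist by (auto simp: h_def)
      ultimately show ?thesis by simp
    qed
    ultimately have "(v, a) \<in> linked (parcs D)" if "v \<in> pverts D" for v
      using that by (auto simp: V)
    then show ?thesis
      by (auto intro: linked_trans linked_sym)
  qed
  have bridges: "all_bridges (parcs D)"
    unfolding all_bridges_def
  proof (intro allI impI notI)
    fix x y assume xy: "(x, y) \<in> parcs D" and l: "(x, y) \<in> linked (parcs D - {(x, y)})"
    have bW: "(u, v) \<notin> linked (?rW - {(u, v)})" if "(u, v) \<in> ?rW" for u v
      using assms(1) that by (auto simp: Q_graph_iff all_bridges_def)
    have bE: "(u, v) \<notin> linked (?rE - {(u, v)})" if "(u, v) \<in> ?rE" for u v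
      using assms(2) that by (auto simp: Q_graph_iff all_bridges_def)
    show False
    proof (cases "(x, y) \<in> ?rE")
      case False
      \<comment> \<open>The E-side shrinks to \<open>b\<close>: its arcs become trivial,
        \<open>(a, d)\<close> becomes \<open>(a, b)\<close>, and only \<open>(x, y)\<close> itself
        is mapped to the image of \<open>(x, y)\<close>.\<close>
      define g where "g v = (if v \<in> ?VE then b else v)" for v
      have "(x, y) = (a, d) \<or> (x, y) \<in> ?rW"
        using xy False by (auto simp: r)
      then have g: "g x = x" "g y = (if (x, y) = (a, d) then b else y)"
        using arcW[of x y] notin mem by (auto simp: g_def)
      have gxy: "(g x, g y) \<in> ?rW"
        using xy False ab(1) g by (auto simp: r)
      have "(g x, g y) \<in> linked (?rW - {(g x, g y)})"
      proof (rule linked_hom[OF l])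
        fix u v assume uv: "(u, v) \<in> parcs D - {(x, y)}"
        then consider "(u, v) \<in> ?rW" "(u, v) \<noteq> (a, b)" | "(u, v) \<in> ?rE" | "(u, v) = (a, d)"
          unfolding r by blast
        then show "(g u, g v) \<in> linked (?rW - {(g x, g y)})"
        proof cases
          case 1
          then have "g u = u" "g v = v"
            using arcW[of u v] by (auto simp: g_def)
          moreover have "(u, v) \<noteq> (g x, g y)"
            using 1 uv g by auto
          ultimately show ?thesis
            using 1 by (auto intro!: linked_arc)
        next
          case 2
          then show ?thesis
            using arcE[of u v] by (auto simp: g_def)
        next
          case 3
          then have "g u = a" "g v = b"
            using mem notin by (auto simp: g_def)
          moreover have "(g x, g y) \<noteq> (a, b)"
            using 3 uv xy g False by (auto simp: r)
          ultimately show ?thesis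
            using ab(1) by (auto intro!: linked_arc)
        qed
      qed
      with bW[OF gxy] show False ..
    next
      case True
      \<comment> \<open>Dually, the W-side shrinks to \<open>c\<close>. Now \<open>(a, d)\<close>
        becomes \<open>(c, d)\<close>, which by \<open>ne\<close> is still present after
        \<open>(x, y)\<close> is deleted.\<close>
      define g where "g v = (if v \<in> ?VW then c else v)" for v
      have ne: "(x, y) \<noteq> (c, d)"
        using xy arcW[of x y] mem dist by (auto simp: r)
      have g: "g x = x" "g y = y"
        using arcE[OF True] by (auto simp: g_def)
      have "(g x, g y) \<in> linked (?rE - {(x, y)})"
      proof (rule linked_hom[OF l])
        fix u v assume uv: "(u, v) \<in> parcs D - {(x, y)}"
        then consider "(u, v) \<in> ?rE" | "(u, v) \<in> ?rW" | "(u, v) = (a, d)"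
          unfolding r by blast
        then show "(g u, g v) \<in> linked (?rE - {(x, y)})"
        proof cases
          case 1
          then have "g u = u" "g v = v"
            using arcE[of u v] by (auto simp: g_def)
          with 1 uv show ?thesis
            by (auto intro!: linked_arc)
        next
          case 2
          then show ?thesis
            using arcW[of u v] by (auto simp: g_def)
        next
          case 3
          then have "g u = c" "g v = d"
            using mem notin by (auto simp: g_def)
          then show ?thesis
            using cd(1) ne by (auto intro!: linked_arc)
        qed
      qed
      with bE[OF True] g show False by simp
    qed
  qed
  have "WE_functional D"
  proof -
    have fW: "WE_functional DW" and fE: "WE_functional DE"
      using assms by (simp_all add: Q_graph_iff)
    \<comment> \<open>On the W-side \<open>(a, d)\<close> stands in for \<open>(a, b)\<close>, so
      functionality of \<open>DW\<close> at \<open>x\<close> decides. On the E-side \<open>x\<close>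
      cannot be \<open>d\<close>, where \<open>(a, d)\<close> ends, so \<open>x\<close> is already
      without predecessors in \<open>DE\<close>.\<close>
    have W: "y = z" if x: "\<nexists>u. (u, x) \<in> parcs D" "(x, y) \<in> parcs D" "(x, z) \<in> parcs D" for x y z
    proof (cases "x \<in> ?VW")
      case True
      then have arcs: "(x, v) \<in> ?rW \<and> v \<noteq> b \<or> x = a \<and> v = d" if "(x, v) \<in> parcs D" for v
        using that arcE[of x v] ab(3)[of x] by (auto simp: r)
      have "x \<noteq> b"
        using arcs[OF x(2)] ab(2) irr by auto
      then have "(u, x) \<notin> ?rW" for u
        using x(1) by (auto simp: r)
      then have "y' = z'" if "(x, y') \<in> ?rW" "(x, z') \<in> ?rW" for y' z'
        using fW that unfolding WE_functional_iff[OF wf(1)] by blast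
      then show ?thesis
        using arcs[OF x(2)] arcs[OF x(3)] ab(1) by blast
    next
      case False
      then have arcs: "(x, v) \<in> ?rE" "x \<noteq> d" if "(x, v) \<in> parcs D" for v
        using that x(1) arcW[of x v] mem by (auto simp: r)
      have "(u, x) \<notin> ?rE" for u
        using x(1) cd(3)[of x] arcs(2)[OF x(2)] by (auto simp: r)
      then show ?thesis
        using fE arcs(1)[OF x(2)] arcs(1)[OF x(3)] unfolding WE_functional_iff[OF wf(2)] by blast
    qed
    have E: "y = z" if x: "\<nexists>u. (x, u) \<in> parcs D" "(y, x) \<in> parcs D" "(z, x) \<in> parcs D" for x y z
    proof (cases "x \<in> ?VE")
      case True
      then have arcs: "(v, x) \<in> ?rE \<and> v \<noteq> c \<or> v = a \<and> x = d" if "(v, x) \<in> parcs D" for v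
        using that arcW[of v x] cd(3)[of x] by (auto simp: r)
      have "x \<noteq> c"
        using arcs[OF x(2)] cd(2) irr by auto
      then have "(x, u) \<notin> ?rE" for u
        using x(1) by (auto simp: r)
      then have "y' = z'" if "(y', x) \<in> ?rE" "(z', x) \<in> ?rE" for y' z'
        using fE that unfolding WE_functional_iff[OF wf(2)] by blast
      then show ?thesis
        using arcs[OF x(2)] arcs[OF x(3)] cd(1) by blast
    next
      case False
      then have arcs: "(v, x) \<in> ?rW" "x \<noteq> a" if "(v, x) \<in> parcs D" for v
        using that x(1) arcE[of v x] mem by (auto simp: r)
      have "(x, u) \<notin> ?rW" for u
        using x(1) ab(3)[of x] arcs(2)[OF x(2)] by (auto simp: r)
      then show ?thesis
        using fW arcs(1)[OF x(2)] arcs(1)[OF x(3)] unfolding WE_functional_iff[OF wf(1)] by blast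
    qed
    show ?thesis
      unfolding WE_functional_iff[OF wfD] using W E by blast
  qed
  moreover have "\<exists>v. inner_vertex D v"
  \<comment> \<open>An inner vertex of \<open>DW\<close> is not \<open>b\<close>; if it loses the
    arc \<open>(a, b)\<close>, it is \<open>a\<close> and gains \<open>(a, d)\<close>.\<close>
  proof -
    obtain v where v: "inner_vertex DW v"
      using assms(1) by (auto simp: Q_graph_iff)
    then have "inner_vertex D v"
      unfolding inner_vertex_iff[OF wfD] inner_vertex_iff[OF wf(1)] r using ab by blast
    then show ?thesis ..
  qed
  ultimately show ?thesis
    using oD conn bridges unfolding Q_graph_iff D_def by blast
qed

lemma construction_imp_Q_graph: "construction G \<Longrightarrow> Q_graph (root_graph G)"
  by (induction rule: construction.induct) (auto intro: basic_Q_graph_imp_Q_graph Q_graph_cut)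

section \<open>Splitting at an arc between inner vertices\<close>

text \<open>Since both ends are inner, the arc is neither a W-edge nor an E-edge, each part of the
  split keeps an inner vertex, and each part is smaller than \<open>D\<close>.\<close>

locale inner_arc =
  fixes D :: "'a pair_pre_digraph" and a d :: 'a
  assumes Q: "Q_graph D"
    and arc: "(a, d) \<in> parcs D"
    and inner: "inner_vertex D a" "inner_vertex D d"
begin

text \<open>The component of \<open>a\<close> once the arc is deleted. The other side gets no
  definition of its own: it is the W-side of the reversed graph, see
  \<open>W_side_rev\<close>.\<close>

definition W_side :: "'a set" where
  "W_side = {v. (a, v) \<in> linked (parcs D - {(a, d)})}"

text \<open>The parameter \<open>b\<close> is a new pendant vertex that replaces the whole far side;
  it is to be chosen outside \<open>D\<close>.\<close>

definition W_part :: "'a \<Rightarrow> 'a pair_pre_digraph" where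
  "W_part b = \<lparr>pverts = insert b W_side, parcs = insert (a, b) (Restr (parcs D) W_side)\<rparr>"

lemma W_part_sel [simp]:
  "pverts (W_part b) = insert b W_side"
  "parcs (W_part b) = insert (a, b) (Restr (parcs D) W_side)"
  by (simp_all add: W_part_def)

lemma oriented: "oriented_graph D"
  using Q by (simp add: Q_graph_iff)

lemma wf: "parcs D \<subseteq> pverts D \<times> pverts D"
  using oriented by (simp add: oriented_graph_iff)

lemma ends_mem: "a \<in> pverts D" "d \<in> pverts D"
  using arc wf by auto

lemma ends_neq: "a \<noteq> d"
  using arc oriented by (auto simp: oriented_graph_iff irrefl_def)

lemma start_in_W_side: "a \<in> W_side"
  by (simp add: W_side_def)

lemma end_notin_W_side: "d \<notin> W_side"
  using Q arc by (auto simp: W_side_def Q_graph_iff all_bridges_def)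

lemma W_side_iff:
  assumes "(u, v) \<in> parcs D" "(u, v) \<noteq> (a, d)"
  shows "u \<in> W_side \<longleftrightarrow> v \<in> W_side"
proof -
  have "(u, v) \<in> linked (parcs D - {(a, d)})"
    using assms by (auto intro: linked_arc)
  then show ?thesis
    unfolding W_side_def by (auto intro: linked_trans linked_sym)
qed

lemma W_side_subset: "W_side \<subseteq> pverts D"
proof
  fix v assume "v \<in> W_side"
  then have "(a, v) \<in> linked (parcs D - {(a, d)})"
    by (simp add: W_side_def)
  then show "v \<in> pverts D"
    by (rule linked_closed) (use wf ends_mem in auto)
qed

text \<open>Connectedness comes from collapsing \<open>D\<close> onto the part, the bridge property
  from embedding the part into \<open>D\<close>.\<close>

lemma Q_graph_W_part:
  assumes b: "b \<notin> pverts D"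
  shows "Q_graph (W_part b)"
proof -
  have bW: "b \<notin> W_side"
    using b W_side_subset by blast
  have ab: "a \<noteq> b"
    using start_in_W_side bW by auto
  have wf': "parcs (W_part b) \<subseteq> pverts (W_part b) \<times> pverts (W_part b)"
    using start_in_W_side by auto
  have "finite W_side"
    using W_side_subset oriented finite_subset by (auto simp: oriented_graph_iff)
  moreover have "irrefl (parcs (W_part b))"
    using oriented ab by (auto simp: oriented_graph_iff irrefl_def)
  moreover have "antisym (parcs (W_part b))"
  proof (rule antisymI)
    fix u v assume "(u, v) \<in> parcs (W_part b)" "(v, u) \<in> parcs (W_part b)"
    then have "(u, v) \<in> parcs D" "(v, u) \<in> parcs D"
      using bW ab by auto
    then show "u = v"
      using oriented by (auto simp: oriented_graph_iff dest: antisymD)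
  qed
  ultimately have "oriented_graph (W_part b)"
    using wf' by (auto simp: oriented_graph_iff)
  moreover have "pverts (W_part b) \<times> pverts (W_part b) \<subseteq> linked (parcs (W_part b))"
  proof -
    \<comment> \<open>The far side collapses to \<open>b\<close>; \<open>(a, d)\<close> becomes
      \<open>(a, b)\<close>, and by \<open>W_side_iff\<close> every other arc is kept or becomes
      trivial.\<close>
    define g where "g v = (if v \<in> W_side then v else b)" for v
    have "(g u, g v) \<in> linked (parcs (W_part b))" if "(u, v) \<in> parcs D" for u v
    proof (cases "(u, v) = (a, d)")
      case True
      then show ?thesis
        using start_in_W_side end_notin_W_side by (auto simp: g_def intro: linked_arc)
    next
      case False
      then show ?thesis
        using that W_side_iff[OF that False] by (auto simp: g_def intro: linked_arc)
    qed
    then have "(g u, g v) \<in> linked (parcs (W_part b))" if "u \<in> pverts D" "v \<in> pverts D" for u v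
      using linked_hom[of u v "parcs D" g] Q that by (auto simp: Q_graph_iff)
    moreover have "\<exists>u \<in> pverts D. v = g u" if "v \<in> pverts (W_part b)" for v
    proof (cases "v = b")
      case True
      then show ?thesis
        using ends_mem end_notin_W_side by (auto simp: g_def)
    next
      case False
      with that show ?thesis
        using W_side_subset by (auto simp: g_def)
    qed
    ultimately show ?thesis
      by blast
  qed
  moreover have "all_bridges (parcs (W_part b))"
    unfolding all_bridges_def
  proof (intro allI impI notI)
    fix x y
    assume xy: "(x, y) \<in> parcs (W_part b)" and l: "(x, y) \<in> linked (parcs (W_part b) - {(x, y)})"
    \<comment> \<open>Renaming \<open>b\<close> to \<open>d\<close> embeds the part into
      \<open>D\<close>. Injectivity ensures that no other arc lands on the deleted one.\<close>
    define h where "h v = (if v = b then d else v)" for v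
    have "inj_on h (pverts (W_part b))"
      using end_notin_W_side by (auto simp: inj_on_def h_def)
    moreover have h: "(h u, h v) \<in> parcs D" if "(u, v) \<in> parcs (W_part b)" for u v
      using that ab bW arc by (auto simp: h_def)
    ultimately have "(h u, h v) \<in> parcs D - {(h x, h y)}"
      if "(u, v) \<in> parcs (W_part b) - {(x, y)}" for u v
      using that wf' xy unfolding inj_on_def by blast
    then have "(h x, h y) \<in> linked (parcs D - {(h x, h y)})"
      by (intro linked_hom[OF l] linked_arc)
    then show False
      using h[OF xy] Q by (auto simp: Q_graph_iff all_bridges_def)
  qed
  \<comment> \<open>A predecessor of \<open>a\<close> in \<open>D\<close> lies on the W-side. Hence
    \<open>a\<close> stays inner, and the added arc \<open>(a, b)\<close> is not a W-edge that could
    spoil functionality.\<close>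
  moreover have na: "\<exists>u. (u, a) \<in> parcs (W_part b)"
  proof -
    obtain u where u: "(u, a) \<in> parcs D"
      using inner by (auto simp: inner_vertex_iff[OF wf])
    then have "u \<in> W_side"
      using W_side_iff[OF u] start_in_W_side ends_neq by auto
    with u start_in_W_side show ?thesis
      by auto
  qed
  moreover have "WE_functional (W_part b)"
  proof -
    have fD: "WE_functional D"
      using Q by (simp add: Q_graph_iff)
    have W: "y = z" if "\<nexists>u. (u, x) \<in> parcs (W_part b)"
      "(x, y) \<in> parcs (W_part b)" "(x, z) \<in> parcs (W_part b)" for x y z
    proof -
      have "x \<noteq> a"
        using that(1) na by blast
      then have x: "x \<in> W_side" "(x, y) \<in> parcs D" "(x, z) \<in> parcs D"
        using that by auto
      have "(u, x) \<notin> parcs D" for u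
        using that(1) x(1) W_side_iff[of u x] end_notin_W_side by auto
      with x fD show ?thesis
        unfolding WE_functional_iff[OF wf] by blast
    qed
    have E: "y = z" if "\<nexists>u. (x, u) \<in> parcs (W_part b)"
      "(y, x) \<in> parcs (W_part b)" "(z, x) \<in> parcs (W_part b)" for x y z
    proof (cases "x = b")
      case True
      with that bW show ?thesis by auto
    next
      case False
      then have x: "x \<in> W_side" "(y, x) \<in> parcs D" "(z, x) \<in> parcs D"
        using that by auto
      have "(x, u) \<notin> parcs D" for u
        using that(1) x(1) W_side_iff[of x u] by auto
      with x fD show ?thesis
        unfolding WE_functional_iff[OF wf] by blast
    qed
    show ?thesis
      unfolding WE_functional_iff[OF wf'] using W E by blast
  qed
  moreover have "inner_vertex (W_part b) a"
    unfolding inner_vertex_iff[OF wf'] using na by auto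
  ultimately show ?thesis
    unfolding Q_graph_iff by blast
qed

text \<open>One vertex is added and at least two are dropped: \<open>d\<close> and, as
  \<open>d\<close> is inner, a successor of \<open>d\<close>, which lies on the same side as
  \<open>d\<close>.\<close>

lemma card_W_part: "card (pverts (W_part b)) < card (pverts D)"
proof -
  obtain v where v: "(d, v) \<in> parcs D"
    using inner by (auto simp: inner_vertex_iff[OF wf])
  then have "v \<notin> W_side"
    using W_side_iff[OF v] end_notin_W_side ends_neq by auto
  moreover have "d \<noteq> v" "v \<in> pverts D"
    using v oriented wf by (auto simp: oriented_graph_iff irrefl_def)
  ultimately have sub: "insert d (insert v W_side) \<subseteq> pverts D"
    and "v \<notin> W_side" "d \<notin> insert v W_side"
    using W_side_subset ends_mem end_notin_W_side by auto
  have fin: "finite (pverts D)"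
    using oriented by (simp add: oriented_graph_iff)
  then have "finite W_side"
    using W_side_subset finite_subset by blast
  then have "card (insert b W_side) < card (insert d (insert v W_side))"
    using \<open>v \<notin> W_side\<close> \<open>d \<notin> insert v W_side\<close> by (simp add: card_insert_if)
  also have "\<dots> \<le> card (pverts D)"
    using sub fin by (rule card_mono[rotated])
  finally show ?thesis by simp
qed

text \<open>The edge starts in a W-vertex and so differs from \<open>(a, d)\<close>; then
  \<open>W_side_iff\<close> puts its other end on the same side.\<close>

lemma W_edge_W_part:
  assumes "W_edge D e" "fst e \<in> W_side" "b \<notin> pverts D"
  shows "W_edge (W_part b) e"
proof -
  obtain x y where e: "e = (x, y)"
    by (cases e)
  have xy: "(x, y) \<in> parcs D" "x \<in> W_side" "x \<in> pverts D" "\<And>u. (u, x) \<notin> parcs D"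
    using assms by (auto simp: e W_edge_def W_vertex_def)
  moreover have "x \<noteq> a"
    using xy inner by (auto simp: inner_vertex_iff[OF wf])
  ultimately show ?thesis
    using assms(3) W_side_iff[of x y] by (auto simp: e W_edge_def W_vertex_def)
qed

lemma E_edge_W_part:
  assumes "E_edge D e" "fst e \<in> W_side" "b \<notin> pverts D"
  shows "E_edge (W_part b) e"
proof -
  obtain x y where e: "e = (x, y)"
    by (cases e)
  have xy: "(x, y) \<in> parcs D" "x \<in> W_side" "y \<in> pverts D" "\<And>u. (y, u) \<notin> parcs D"
    using assms by (auto simp: e E_edge_def E_vertex_def)
  moreover have "y \<noteq> a" "y \<noteq> d"
    using xy inner by (auto simp: inner_vertex_iff[OF wf])
  ultimately show ?thesis
    using assms(3) W_side_iff[of x y] by (auto simp: e E_edge_def E_vertex_def)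
qed

end

section \<open>The two sides of the split partition the vertices\<close>

lemma inner_arc_rev: "inner_arc D a d \<Longrightarrow> inner_arc (rev_graph D) d a"
  by (simp add: inner_arc_def)

text \<open>A common vertex of the two sides would link \<open>a\<close> to \<open>d\<close> without
  the arc. Their union contains \<open>a\<close> and \<open>d\<close>, hence is closed under all
  arcs, and \<open>D\<close> is connected.\<close>

lemma (in inner_arc) W_side_rev: "inner_arc.W_side (rev_graph D) d a = pverts D - W_side"
proof -
  interpret R: inner_arc "rev_graph D" d a
    by (rule inner_arc_rev) (rule inner_arc_axioms)
  have R: "R.W_side = {v. (d, v) \<in> linked (parcs D - {(a, d)})}"
  proof -
    have "parcs (rev_graph D) - {(d, a)} = (parcs D - {(a, d)})\<inverse>"
      by auto
    then show ?thesis
      by (simp add: R.W_side_def)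
  qed
  have "R.W_side \<inter> W_side = {}"
  proof (rule ccontr)
    assume "R.W_side \<inter> W_side \<noteq> {}"
    then have "d \<in> W_side"
      unfolding R W_side_def by (auto intro: linked_trans linked_sym)
    then show False
      using end_notin_W_side by blast
  qed
  moreover have "v \<in> R.W_side \<union> W_side" if "v \<in> pverts D" for v
  proof -
    have "(a, v) \<in> linked (parcs D)"
      using Q that ends_mem by (auto simp: Q_graph_iff)
    then show ?thesis
    proof (rule linked_closed)
      fix u w assume "(u, w) \<in> parcs D"
      then show "u \<in> R.W_side \<union> W_side \<longleftrightarrow> w \<in> R.W_side \<union> W_side"
        using W_side_iff[of u w] R.W_side_iff[of w u] start_in_W_side R.start_in_W_side by auto
    qed (use start_in_W_side in simp)
  qed
  ultimately show ?thesis
    using R.W_side_subset by auto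
qed

section \<open>Realizing Q-graphs by constructions\<close>

fun outer_edge :: "'a pair_pre_digraph \<Rightarrow> we \<Rightarrow> 'a \<times> 'a \<Rightarrow> bool" where
  "outer_edge D West = W_edge D"
| "outer_edge D East = E_edge D"

text \<open>The strengthened claim for the induction: both marks on side \<open>X\<close> can be
  prescribed. For a pair \<open>e\<close> that is no outer edge on side \<open>X\<close> it only
  asks for a construction, so \<open>e\<close> can range over all pairs.\<close>

definition realizes :: "'a qtree \<Rightarrow> 'a pair_pre_digraph \<Rightarrow> we \<Rightarrow> 'a \<times> 'a \<Rightarrow> bool" where
  "realizes G D X e \<longleftrightarrow> construction G \<and> root_graph G = D \<and>
     (outer_edge D X e \<longrightarrow> (\<forall>Y. root_mark G Y X = e))"

text \<open>Neighbours of an inner vertex \<open>b\<close> are not inner, so its predecessors are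
  W-vertices and its successors E-vertices. By functionality they have no neighbour besides
  \<open>b\<close>, and by connectedness there are no further vertices.\<close>

lemma basic_realizable:
  assumes Q: "Q_graph D"
    and arcs: "\<And>u v. (u, v) \<in> parcs D \<Longrightarrow> \<not> (inner_vertex D u \<and> inner_vertex D v)"
  shows "\<exists>G. realizes G D X e"
proof -
  have or: "oriented_graph D" and fD: "WE_functional D"
    using Q by (simp_all add: Q_graph_iff)
  have wf: "parcs D \<subseteq> pverts D \<times> pverts D"
    using or by (simp add: oriented_graph_iff)
  obtain b where b: "inner_vertex D b"
    using Q by (auto simp: Q_graph_iff)
  define A where "A = {u. (u, b) \<in> parcs D}"
  define C where "C = {v. (b, v) \<in> parcs D}"
  have ne: "A \<noteq> {}" "C \<noteq> {}"
    using b by (auto simp: inner_vertex_iff[OF wf] A_def C_def)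
  have sub: "A \<subseteq> pverts D" "C \<subseteq> pverts D" "b \<in> pverts D"
    using wf b by (auto simp: A_def C_def inner_vertex_def)
  then have fin: "finite A" "finite C"
    using or by (auto simp: oriented_graph_iff intro: finite_subset)
  have disj: "A \<inter> C = {}" "b \<notin> A" "b \<notin> C"
    using or by (auto simp: oriented_graph_iff irrefl_def A_def C_def dest: antisymD)
  have A: "(u, x) \<notin> parcs D" "(x, v) \<in> parcs D \<Longrightarrow> v = b" if "x \<in> A" for x u v
  proof -
    have xb: "(x, b) \<in> parcs D"
      using that by (simp add: A_def)
    have *: "(u, x) \<notin> parcs D" for u
      using arcs[OF xb] b xb unfolding inner_vertex_iff[OF wf] by blast
    then show "(u, x) \<notin> parcs D" .
    show "(x, v) \<in> parcs D \<Longrightarrow> v = b"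
      using fD xb * unfolding WE_functional_iff[OF wf] by blast
  qed
  have C: "(x, u) \<notin> parcs D" "(v, x) \<in> parcs D \<Longrightarrow> v = b" if "x \<in> C" for x u v
  proof -
    have bx: "(b, x) \<in> parcs D"
      using that by (simp add: C_def)
    have *: "(x, u) \<notin> parcs D" for u
      using arcs[OF bx] b bx unfolding inner_vertex_iff[OF wf] by blast
    then show "(x, u) \<notin> parcs D" .
    show "(v, x) \<in> parcs D \<Longrightarrow> v = b"
      using fD bx * unfolding WE_functional_iff[OF wf] by blast
  qed
  have closed: "u \<in> A \<union> {b} \<union> C \<longleftrightarrow> v \<in> A \<union> {b} \<union> C" if "(u, v) \<in> parcs D" for u v
    using that A C unfolding A_def C_def by blast
  have V: "pverts D = A \<union> {b} \<union> C"
  proof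
    show "pverts D \<subseteq> A \<union> {b} \<union> C"
    proof
      fix v assume "v \<in> pverts D"
      then have "(b, v) \<in> linked (parcs D)"
        using Q sub by (auto simp: Q_graph_iff)
      then show "v \<in> A \<union> {b} \<union> C"
        by (rule linked_closed) (use closed in auto)
    qed
  qed (use sub in auto)
  have r: "parcs D = A \<times> {b} \<union> {b} \<times> C"
  proof (rule equalityI)
    show "parcs D \<subseteq> A \<times> {b} \<union> {b} \<times> C"
    proof (rule subrelI)
      fix u v assume uv: "(u, v) \<in> parcs D"
      then have "u \<in> A \<union> {b} \<union> C"
        using wf V by blast
      moreover have "u = b \<Longrightarrow> v \<in> C"
        using uv by (simp add: C_def)
      ultimately show "(u, v) \<in> A \<times> {b} \<union> {b} \<times> C"
        using uv A(2)[of u v] C(1)[of u v] by blast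
    qed
    show "A \<times> {b} \<union> {b} \<times> C \<subseteq> parcs D"
      by (auto simp: A_def C_def)
  qed
  obtain p q where pq: "p \<in> A" "q \<in> C"
    using ne by blast
  have out: "W_edge D (p, b)" "E_edge D (b, q)"
  proof -
    have "(p, b) \<in> parcs D" "(b, q) \<in> parcs D" "p \<in> pverts D" "q \<in> pverts D"
      using pq unfolding r V by blast+
    then show "W_edge D (p, b)" "E_edge D (b, q)"
      using A(1)[OF pq(1)] C(1)[OF pq(2)]
      by (simp_all add: W_edge_def W_vertex_def E_edge_def E_vertex_def)
  qed
  \<comment> \<open>A basic Q-graph may carry any outer edges as marks; \<open>(p, b)\<close> and
    \<open>(b, q)\<close> are arbitrary choices where \<open>e\<close> is not prescribed.\<close>
  define m where "m = (\<lambda>(Y :: ns) Z. if Z = X \<and> outer_edge D X e then e else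
    (case Z of West \<Rightarrow> (p, b) | East \<Rightarrow> (b, q)))"
  have "basic_Q_graph (Marked D m)"
    unfolding basic_Q_graph_def
  proof (intro conjI allI)
    show "\<exists>A b C. finite A \<and> A \<noteq> {} \<and> finite C \<and> C \<noteq> {} \<and> A \<inter> C = {} \<and> b \<notin> A \<and> b \<notin> C \<and>
        pverts (graph (Marked D m)) = A \<union> {b} \<union> C \<and>
        parcs (graph (Marked D m)) = A \<times> {b} \<union> {b} \<times> C"
      using fin ne disj V r by (intro exI[of _ A] exI[of _ b] exI[of _ C]) simp
  qed (use or out in \<open>auto simp: m_def\<close>)
  then have "construction (Tip (Marked D m))"
    by (rule construction.basic)
  then have "realizes (Tip (Marked D m)) D X e"
    by (simp add: realizes_def m_def)
  then show ?thesis ..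
qed

text \<open>The part containing \<open>e\<close> has its marks on side \<open>X\<close> spent on
  \<open>e\<close>; the other part is free to take the cut edge as both of its marks facing the cut,
  which satisfies the side condition of \<open>cut\<close>.\<close>

lemma (in inner_arc) realizable_step:
  assumes inf: "infinite (UNIV :: 'a set)"
    and IH: "\<And>(D' :: 'a pair_pre_digraph) X e.
      Q_graph D' \<Longrightarrow> card (pverts D') < card (pverts D) \<Longrightarrow> \<exists>G. realizes G D' X e"
  shows "\<exists>G. realizes G D X e"
proof -
  interpret R: inner_arc "rev_graph D" d a
    by (rule inner_arc_rev) (rule inner_arc_axioms)
  have fin: "finite (pverts D)"
    using oriented by (simp add: oriented_graph_iff)
  obtain b where b: "b \<notin> pverts D"
    using ex_new_if_finite[OF inf fin] by blast
  \<comment> \<open>The two pendant vertices must also differ from each other, so that the parts are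
    disjoint.\<close>
  obtain c where c: "c \<notin> insert b (pverts D)"
    using ex_new_if_finite[OF inf, of "insert b (pverts D)"] fin by blast
  define DW where "DW = W_part b"
  \<comment> \<open>The E-part is the W-part of the reversed graph, turned back.\<close>
  define DE where "DE = rev_graph (R.W_part c)"
  have VW: "pverts DW = insert b W_side" and VE: "pverts DE = insert c (pverts D - W_side)"
    by (simp_all add: DW_def DE_def W_side_rev)
  have rW: "parcs DW = insert (a, b) (Restr (parcs D) W_side)"
    and rE: "parcs DE = insert (c, d) (Restr (parcs D) (pverts D - W_side))"
    by (auto simp: DW_def DE_def W_side_rev)
  have disj: "pverts DW \<inter> pverts DE = {}"
    using b c W_side_subset by (auto simp: VW VE)
  have QW: "Q_graph DW"
    using Q_graph_W_part b by (simp add: DW_def)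
  have QE: "Q_graph DE"
    using R.Q_graph_W_part c by (simp add: DE_def)
  have realW: "\<exists>G. realizes G DW Z f" for Z f
    by (rule IH[OF QW]) (unfold DW_def, rule card_W_part)
  have realE: "\<exists>G. realizes G DE Z f" for Z f
    by (rule IH[OF QE]) (use R.card_W_part[of c] in \<open>simp only: DE_def rev_graph_sel\<close>)
  have "E_edge DW (a, b)"
    using b W_side_subset start_in_W_side by (auto simp: E_edge_def E_vertex_def VW rW)
  moreover have "W_edge DE (c, d)"
    using c W_side_subset ends_mem end_notin_W_side by (auto simp: W_edge_def W_vertex_def VE rE)
  ultimately have outer: "outer_edge DW East (a, b)" "outer_edge DE West (c, d)"
    by simp_all
  then have func: "functional_E_edge DW (a, b)" "functional_W_edge DE (c, d)"
    using QW QE by (simp_all add: Q_graph_iff WE_functional_def)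
  \<comment> \<open>Every arc except \<open>(a, d)\<close> lies within one side, and the cut
    restores \<open>(a, d)\<close> in exchange for the two pendant arcs.\<close>
  have D_eq: "cut_graph DW (a, b) (c, d) DE = D"
  proof (rule pair_pre_digraph.equality)
    show "pverts (cut_graph DW (a, b) (c, d) DE) = pverts D"
      using b c W_side_subset by (auto simp: cut_graph_def VW VE)
    have "(u, v) \<in> parcs D \<longleftrightarrow> (u, v) \<in> parcs (cut_graph DW (a, b) (c, d) DE)" for u v
      using b c W_side_subset W_side_iff[of u v] wf arc by (auto simp: cut_graph_def rW rE)
    then show "parcs (cut_graph DW (a, b) (c, d) DE) = parcs D"
      by auto
  qed simp
  have glue: "\<exists>G. construction G \<and> root_graph G = D \<and>
      root_mark G = cut_mark (root GW) (a, b) (c, d) (root GE)"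
    if "realizes GW DW X1 e1" "realizes GE DE X2 e2"
      "(\<forall>Y. root_mark GW Y East = (a, b)) \<or> (\<forall>Y. root_mark GE Y West = (c, d))"
    for GW GE X1 X2 e1 e2
  proof -
    have "construction (Branch (Marked (cut_graph DW (a, b) (c, d) DE)
        (cut_mark (root GW) (a, b) (c, d) (root GE))) GW GE)"
      using that disj func construction.cut[of GW GE "(a, b)" "(c, d)"] by (auto simp: realizes_def)
    then show ?thesis
      using D_eq by (intro exI conjI) auto
  qed
  \<comment> \<open>Because \<open>e\<close> differs from both cut edges, \<open>cut_mark\<close>
    keeps it when it marks the side of its part that faces the cut.\<close>
  have mem: "fst e \<in> pverts D" "e \<noteq> (a, b)" "e \<noteq> (c, d)" if "outer_edge D X e"
    using that wf b c by (cases X; cases e; auto simp: W_edge_def E_edge_def)+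
  have edgeW: "outer_edge DW X e" if "outer_edge D X e" "fst e \<in> W_side"
    using that W_edge_W_part E_edge_W_part b unfolding DW_def by (cases X) auto
  have edgeE: "outer_edge DE X e" if "outer_edge D X e" "fst e \<notin> W_side"
  proof -
    obtain x y where e: "e = (x, y)"
      by (cases e)
    have xy: "(x, y) \<in> parcs D" "x \<noteq> a \<or> y \<noteq> d"
      using that inner by (cases X; auto simp: e W_edge_def E_edge_def inner_vertex_def)+
    \<comment> \<open>In the reversed graph the edge starts in \<open>y\<close>, so it is the side
      of \<open>y\<close> that the reversed transfer lemmas ask for.\<close>
    then have "y \<in> R.W_side"
      using that W_side_iff[of x y] wf by (auto simp: e W_side_rev)
    then show ?thesis
      using that R.W_edge_W_part[of "(y, x)" c] R.E_edge_W_part[of "(y, x)" c] c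
      unfolding DE_def by (cases X) (auto simp: e)
  qed
  show ?thesis
  proof (cases "fst e \<in> W_side")
    case True
    obtain GW GE where G: "realizes GW DW X e" "realizes GE DE West (c, d)"
      using realW realE by metis
    moreover have marks: "\<forall>Y. root_mark GE Y West = (c, d)"
      using G outer by (auto simp: realizes_def)
    ultimately obtain G where "construction G" "root_graph G = D"
      "root_mark G = cut_mark (root GW) (a, b) (c, d) (root GE)"
      using glue by blast
    then have "realizes G D X e"
      using G marks edgeW mem True by (cases X) (auto simp: realizes_def cut_mark_def)
    then show ?thesis ..
  next
    case False
    obtain GW GE where G: "realizes GW DW East (a, b)" "realizes GE DE X e"
      using realW realE by metis
    moreover have marks: "\<forall>Y. root_mark GW Y East = (a, b)"
      using G outer by (auto simp: realizes_def)
    ultimately obtain G where "construction G" "root_graph G = D"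
      "root_mark G = cut_mark (root GW) (a, b) (c, d) (root GE)"
      using glue by blast
    then have "realizes G D X e"
      using G marks edgeE mem False by (cases X) (auto simp: realizes_def cut_mark_def)
    then show ?thesis ..
  qed
qed

text \<open>\<open>X\<close> and \<open>e\<close> are generalized in the induction, since the two
  parts are realized with different prescribed marks.\<close>

lemma Q_graph_realizable:
  fixes D :: "'a::infinite pair_pre_digraph"
  assumes "Q_graph D"
  shows "\<exists>G. realizes G D X e"
  using assms
proof (induction "card (pverts D)" arbitrary: D X e rule: less_induct)
  case less
  show ?case
  proof (cases "\<exists>a d. (a, d) \<in> parcs D \<and> inner_vertex D a \<and> inner_vertex D d")
    case True
    then obtain a d where "inner_arc D a d"
      using less.prems by (auto simp: inner_arc_def)
    then show ?thesis
      by (rule inner_arc.realizable_step) (use less.hyps infinite_UNIV in auto)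
  next
    case False
    then show ?thesis
      using basic_realizable less.prems by blast
  qed
qed

theorem mainTheorem16:
  fixes D :: "'a::infinite pair_pre_digraph"
  assumes "oriented_graph D"
  shows "Q_graph D \<longleftrightarrow> global_Q_graph D"
proof
  assume "Q_graph D"
  then obtain G where "construction G" "root_graph G = D"
    using Q_graph_realizable unfolding realizes_def by blast
  with assms show "global_Q_graph D"
    by (auto simp: global_Q_graph_def)
next
  assume "global_Q_graph D"
  then show "Q_graph D"
    using construction_imp_Q_graph by (auto simp: global_Q_graph_def)
qed

end
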